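(* Consider a Markov decision process $(r,\Gamma,\beta,P)$ with state space $\mathsf X$ and action space $\mathsf A$ satisfying the standing assumptions described in the context, and let $\sigma\in\Sigma$. If $P_\sigma$ is strongly irreducible, then the following three statements are equivalent: (E1) there exists $x\in\mathsf X$ such that $v_s(x)\le v_\sigma(x)$ for all $s\in\Sigma$; (E2) there exists a Borel probability measure $\rho$ on $\mathsf X$ such that $\int v_s\,\mathrm d\rho\le\int v_\sigma\,\mathrm d\rho$ for all $s\in\Sigma$; (E3) $\sigma$ is an optimal policy, i.e. $v_\sigma(x)=v^*(x)$ for all $x\in\mathsf X$.
   Context: $\mathsf X$ and $\mathsf A$ are metric spaces; $b\mathsf X$ is the Banach space of bounded Borel measurable functions $\mathsf X\to\mathbb R$ with the supremum norm and the pointwise order, $b\mathsf X_+$ its nonnegative elements, $cb\mathsf X$ the continuous elements; $b\mathsf X'$ is the (norm) dual of $b\mathsf X$ and $b\mathsf X'_+$ the set of positive functionals ($\mu(f)\ge0$ whenever $f\ge0$). A Markov decision process is a tuple $(r,\Gamma,\beta,P)$ where: $\beta\in(0,1)$; $\Gamma$ is a nonempty, compact-valued, continuous correspondence from $\mathsf X$ to $\mathsf A$; with $\mathsf G=\{(x,a): a\in\Gamma(x)\}$, $r:\mathsf G\to\mathbb R$ is bounded and continuous; for each $(x,a)\in\mathsf G$, $P(x,a,\cdot)$ is a Borel probability measure on $\mathsf X$, and $(x,a)\mapsto\int v(x')P(x,a,\mathrm dx')$ is continuous on $\mathsf G$ for every $v\in cb\mathsf X$. $\Sigma$ is the set of Borel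 measurable $\sigma:\mathsf X\to\mathsf A$ with $\sigma(x)\in\Gamma(x)$ for all $x$. For $\sigma\in\Sigma$, $r_\sigma(x)=r(x,\sigma(x))$, $P_\sigma(x,\mathrm dx')=P(x,\sigma(x),\mathrm dx')$ with Markov operator $(P_\sigma f)(x)=\int f(x')P_\sigma(x,\mathrm dx')$ on $b\mathsf X$, and $v_\sigma=\sum_{t\ge0}(\beta P_\sigma)^t r_\sigma$ (the unique fixed point in $b\mathsf X$ of $v\mapsto r_\sigma+\beta P_\sigma v$). The value function is $v^*(x)=\sup_{s\in\Sigma}v_s(x)$; $\sigma$ is optimal if $v_\sigma=v^*$ on $\mathsf X$. An ideal of $b\mathsf X$ is a linear subspace $I$ such that $f\in I$ and $|g|\le|f|$ imply $g\in I$; it is invariant for a linear operator $K$ if $KI\subset I$. A positive linear operator $K$ on $b\mathsf X$ is irreducible if its only invariant ideals are $\{0\}$ and $b\mathsf X$; equivalently (a standard fact), for every nonzero $f\in b\mathsf X_+$ and every nonzero $\mu\in b\mathsf X'_+$ there is $m\in\mathbb N=\{1,2,\dots\}$ with $\mu(K^m f)>0$. A transition kernel on $\mathsf X$ is strongly irreducible if its Markov operator $f\mapsto\int f(x')Q(x,\mathrm dx')$ is irreducible on $b\mathsf X$ in this sense. *)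

theory Defs
  imports "HOL-Probability.Probability"
begin

definition bX :: "('x::metric_space \<Rightarrow> real) set" where
  "bX = {f. f \<in> borel_measurable borel \<and> bounded (range f)}"

definition cbX :: "('x::metric_space \<Rightarrow> real) set" where
  "cbX = {f. continuous_on UNIV f \<and> bounded (range f)}"

definition is_ideal :: "('x::metric_space \<Rightarrow> real) set \<Rightarrow> bool" where
  "is_ideal I \<longleftrightarrow> I \<subseteq> bX \<and> (\<lambda>x. 0) \<in> I
     \<and> (\<forall>f\<in>I. \<forall>g\<in>I. (\<lambda>x. f x + g x) \<in> I)
     \<and> (\<forall>c::real. \<forall>f\<in>I. (\<lambda>x. c * f x) \<in> I)
     \<and> (\<forall>f\<in>I. \<forall>g\<in>bX. (\<forall>x. \<bar>g x\<bar> \<le> \<bar>f x\<bar>) \<longrightarrow> g \<in> I)"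

definition invariant_ideal ::
    "(('x::metric_space \<Rightarrow> real) \<Rightarrow> ('x \<Rightarrow> real)) \<Rightarrow> ('x \<Rightarrow> real) set \<Rightarrow> bool" where
  "invariant_ideal K I \<longleftrightarrow> is_ideal I \<and> (\<forall>f\<in>I. K f \<in> I)"

definition irreducible_op ::
    "(('x::metric_space \<Rightarrow> real) \<Rightarrow> ('x \<Rightarrow> real)) \<Rightarrow> bool" where
  "irreducible_op K \<longleftrightarrow>
     (\<forall>I. invariant_ideal K I \<longrightarrow> I = {\<lambda>x. 0} \<or> I = bX)"

definition markov_op :: "('x::metric_space \<Rightarrow> 'x measure) \<Rightarrow> ('x \<Rightarrow> real) \<Rightarrow> ('x \<Rightarrow> real)" where
  "markov_op Q f = (\<lambda>x. integral\<^sup>L (Q x) f)"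

definition strongly_irreducible :: "('x::metric_space \<Rightarrow> 'x measure) \<Rightarrow> bool" where
  "strongly_irreducible Q \<longleftrightarrow> irreducible_op (markov_op Q)"

definition upper_hemicont :: "('x::topological_space \<Rightarrow> 'a::topological_space set) \<Rightarrow> bool" where
  "upper_hemicont \<Gamma> \<longleftrightarrow> (\<forall>x U. open U \<and> \<Gamma> x \<subseteq> U \<longrightarrow>
      (\<exists>V. open V \<and> x \<in> V \<and> (\<forall>y\<in>V. \<Gamma> y \<subseteq> U)))"

definition lower_hemicont :: "('x::topological_space \<Rightarrow> 'a::topological_space set) \<Rightarrow> bool" where
  "lower_hemicont \<Gamma> \<longleftrightarrow> (\<forall>x U. open U \<and> \<Gamma> x \<inter> U \<noteq> {} \<longrightarrow>
      (\<exists>V. open V \<and> x \<in> V \<and> (\<forall>y\<in>V. \<Gamma> y \<inter> U \<noteq> {})))"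

definition graph_corr :: "('x \<Rightarrow> 'a set) \<Rightarrow> ('x \<times> 'a) set" where
  "graph_corr \<Gamma> = {(x, a). a \<in> \<Gamma> x}"

definition is_MDP ::
    "('x::metric_space \<times> 'a::metric_space \<Rightarrow> real) \<Rightarrow> ('x \<Rightarrow> 'a set) \<Rightarrow> real
      \<Rightarrow> ('x \<Rightarrow> 'a \<Rightarrow> 'x measure) \<Rightarrow> bool" where
  "is_MDP r \<Gamma> \<beta> P \<longleftrightarrow>
     0 < \<beta> \<and> \<beta> < 1
     \<and> (\<forall>x. \<Gamma> x \<noteq> {} \<and> compact (\<Gamma> x))
     \<and> upper_hemicont \<Gamma> \<and> lower_hemicont \<Gamma>
     \<and> bounded (r ` graph_corr \<Gamma>) \<and> continuous_on (graph_corr \<Gamma>) r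
     \<and> (\<forall>(x, a)\<in>graph_corr \<Gamma>. prob_space (P x a) \<and> sets (P x a) = sets borel)
     \<and> (\<forall>v\<in>cbX. continuous_on (graph_corr \<Gamma>) (\<lambda>(x, a). integral\<^sup>L (P x a) v))"

definition policies :: "('x::metric_space \<Rightarrow> 'a::metric_space set) \<Rightarrow> ('x \<Rightarrow> 'a) set" where
  "policies \<Gamma> = {\<sigma>. \<sigma> \<in> borel_measurable borel \<and> (\<forall>x. \<sigma> x \<in> \<Gamma> x)}"

definition r_pol :: "('x \<times> 'a \<Rightarrow> real) \<Rightarrow> ('x \<Rightarrow> 'a) \<Rightarrow> 'x \<Rightarrow> real" where
  "r_pol r \<sigma> = (\<lambda>x. r (x, \<sigma> x))"

definition P_pol :: "('x \<Rightarrow> 'a \<Rightarrow> 'x measure) \<Rightarrow> ('x \<Rightarrow> 'a) \<Rightarrow> 'x \<Rightarrow> 'x measure" where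
  "P_pol P \<sigma> = (\<lambda>x. P x (\<sigma> x))"

definition v_pol ::
    "('x::metric_space \<times> 'a \<Rightarrow> real) \<Rightarrow> real \<Rightarrow> ('x \<Rightarrow> 'a \<Rightarrow> 'x measure) \<Rightarrow> ('x \<Rightarrow> 'a) \<Rightarrow> 'x \<Rightarrow> real" where
  "v_pol r \<beta> P \<sigma> = (\<lambda>x. \<Sum>t. \<beta> ^ t * ((markov_op (P_pol P \<sigma>) ^^ t) (r_pol r \<sigma>)) x)"

definition v_star ::
    "('x::metric_space \<times> 'a::metric_space \<Rightarrow> real) \<Rightarrow> ('x \<Rightarrow> 'a set) \<Rightarrow> real
      \<Rightarrow> ('x \<Rightarrow> 'a \<Rightarrow> 'x measure) \<Rightarrow> 'x \<Rightarrow> real" where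
  "v_star r \<Gamma> \<beta> P = (\<lambda>x. SUP s\<in>policies \<Gamma>. v_pol r \<beta> P s x)"

definition optimal ::
    "('x::metric_space \<times> 'a::metric_space \<Rightarrow> real) \<Rightarrow> ('x \<Rightarrow> 'a set) \<Rightarrow> real
      \<Rightarrow> ('x \<Rightarrow> 'a \<Rightarrow> 'x measure) \<Rightarrow> ('x \<Rightarrow> 'a) \<Rightarrow> bool" where
  "optimal r \<Gamma> \<beta> P \<sigma> \<longleftrightarrow> (\<forall>x. v_pol r \<beta> P \<sigma> x = v_star r \<Gamma> \<beta> P x)"

end

theory Submission
  imports Defs
begin

text \<open>
  Suppose \<open>\<sigma>\<close> is maximal on average with respect to \<open>\<rho>\<close> (a point mass in the case of a single
  state), and that some policy is better somewhere. Switching policies statewise gives \<open>s\<close> with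
  \<open>h = v\<^sub>s - v\<^sub>\<sigma> \<ge> 0\<close>, \<open>h \<noteq> 0\<close>. Following \<open>\<sigma>\<close> for one more period before \<open>s\<close>, wherever this helps,
  gives by iteration policies \<open>s\<^sub>m\<close> with \<open>v\<^bsub>s\<^sub>m\<^esub> - v\<^sub>\<sigma> \<ge> (\<beta> P\<^sub>\<sigma>)\<^sup>m h\<close>, so maximality forces
  \<open>\<integral> P\<^sub>\<sigma>\<^sup>m h d\<rho> = 0\<close> for all \<open>m\<close>. The functions \<open>f\<close> with \<open>\<integral> P\<^sub>\<sigma>\<^sup>m \<bar>f\<bar> d\<rho> = 0\<close> for all \<open>m\<close> form an invariant
  ideal that contains \<open>h\<close> but not \<open>1\<close>, contradicting irreducibility. No optimal policy, hence no
  measurable selection of maximisers, is needed.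

  The spaces are not assumed separable, so it is not obvious that \<open>x \<mapsto> (x, s x)\<close> is Borel for a
  Borel policy \<open>s\<close>. By compactness of the values of the correspondence this reduces to
  sets \<open>\<Union>\<^sub>j V\<^sub>j \<inter> s\<^sup>-\<^sup>1(B\<^sub>j)\<close> with two disjoint families of open sets. If there are at most continuum many
  indices, such a set is a countable Boolean combination of Borel sets; in general, a diagonal
  argument over Borel codes, of which there are only continuum many, shows that all the pieces
  have a common code, and then their union has it too.
\<close>

section \<open>Disjoint unions of Borel sets in nonseparable spaces\<close>

text \<open>Stone's theorem, in the weak form where each layer is only disjoint and not discrete.\<close>

lemma sigma_disjoint_refinement:
  fixes C :: "'i \<Rightarrow> 'x::metric_space set"
  assumes open_C: "\<And>i. open (C i)" and cover: "(\<Union>i. C i) = UNIV"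
  obtains D :: "nat \<Rightarrow> 'i \<Rightarrow> 'x set"
  where "\<And>n i. open (D n i)" "\<And>n i. D n i \<subseteq> C i" "\<And>n. disjoint_family (D n)"
    "(\<Union>n. \<Union>i. D n i) = UNIV"
proof -
  obtain R :: "'i rel" where R: "well_order_on UNIV R"
    using well_order_on by blast
  have wf: "wf (R - Id)" and total: "\<And>i j. i \<noteq> j \<Longrightarrow> (i, j) \<in> R - Id \<or> (j, i) \<in> R - Id"
    using R by (auto simp: well_order_on_def linear_order_on_def total_on_def)
  \<comment> \<open>The least index, in the well-order, whose set contains \<open>x\<close>.\<close>
  define first where "first x i \<longleftrightarrow> x \<in> C i \<and> (\<forall>j. (j, i) \<in> R - Id \<longrightarrow> x \<notin> C j)" for x i
  have ex_first: "\<exists>i. first x i" for x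
  proof -
    obtain i where "i \<in> {i. x \<in> C i}" using cover by blast
    then obtain j where "j \<in> {i. x \<in> C i}" "\<And>y. (y, j) \<in> R - Id \<Longrightarrow> y \<notin> {i. x \<in> C i}"
      using wfE_min[OF wf, of i "{i. x \<in> C i}"] by metis
    then show ?thesis unfolding first_def by blast
  qed
  define e :: "nat \<Rightarrow> real" where "e n = 1 / (real n + 1)" for n
  have e_pos: "e n > 0" for n by (simp add: e_def)
  \<comment> \<open>Centres in the same layer with different first indices are at least
    \<open>3 * e n\<close> apart: the one with the later index lies outside the earlier set, which
    contains the \<open>3 * e n\<close>-ball about the other. Hence balls of radius
    \<open>e n\<close> cannot meet.\<close>
  define D where "D n i = (\<Union>c\<in>{c. first c i \<and> ball c (3 * e n) \<subseteq> C i}. ball c (e n))" for n i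
  have disj: "D n i \<inter> D n j = {}" if ij: "(i, j) \<in> R - Id" for n i j
  proof -
    have False if x: "x \<in> D n i" "x \<in> D n j" for x
    proof -
      obtain c d where c: "first c i" "ball c (3 * e n) \<subseteq> C i" "dist c x < e n"
        and d: "first d j" "dist d x < e n"
        using x unfolding D_def by auto
      have "d \<notin> C i" using d(1) ij unfolding first_def by blast
      then have "dist c d \<ge> 3 * e n" using c(2) by (auto simp: subset_iff not_less)
      moreover have "dist c d \<le> dist c x + dist d x" by (rule dist_triangle2)
      ultimately show False using c(3) d(2) e_pos[of n] by linarith
    qed
    then show ?thesis by blast
  qed
  show thesis
  proof
    show "open (D n i)" for n i unfolding D_def by auto
    show "D n i \<subseteq> C i" for n i
      unfolding D_def using e_pos[of n] by (force simp: subset_iff)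
    show "disjoint_family (D n)" for n
      unfolding disjoint_family_on_def using disj total by (metis Int_commute)
    have "\<exists>n i. x \<in> D n i" for x
    proof -
      obtain i where i: "first x i" using ex_first by blast
      then obtain \<epsilon> where \<epsilon>: "\<epsilon> > 0" "ball x \<epsilon> \<subseteq> C i"
        using open_C unfolding first_def by (metis open_contains_ball)
      obtain n where n: "inverse (real (Suc n)) < \<epsilon> / 3"
        using reals_Archimedean[of "\<epsilon> / 3"] \<epsilon>(1) by auto
      then have "3 * e n \<le> \<epsilon>" by (simp add: e_def field_simps)
      then have "ball x (3 * e n) \<subseteq> C i" using \<epsilon>(2) subset_ball by blast
      then have "x \<in> D n i" unfolding D_def using i e_pos[of n] by auto
      then show ?thesis by blast
    qed
    then show "(\<Union>n. \<Union>i. D n i) = UNIV" by blast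
  qed
qed

section \<open>Borel codes and their cardinality\<close>

text \<open>\<open>Node c\<close> denotes the complement of a countable union, which generates all Boolean operations.\<close>

datatype borel_code = Gen nat | Node "nat \<Rightarrow> borel_code"

primrec denote :: "(nat \<Rightarrow> 'x set) \<Rightarrow> borel_code \<Rightarrow> 'x set" where
  "denote U (Gen n) = U n"
| "denote U (Node c) = - (\<Union>i. denote U (c i))"

text \<open>Lets countably many codes draw on one interleaved sequence of generators.\<close>

primrec rename :: "(nat \<Rightarrow> nat) \<Rightarrow> borel_code \<Rightarrow> borel_code" where
  "rename h (Gen n) = Gen (h n)"
| "rename h (Node c) = Node (\<lambda>i. rename h (c i))"

lemma denote_rename: "denote U (rename h c) = denote (U \<circ> h) c"
  by (induction c) auto

text \<open>Complement and union act pointwise, so a code sees a point only through the generators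
  containing it. This later permits gluing generators along disjoint sets.\<close>

lemma mem_denote_cong:
  assumes "\<And>n. x \<in> U n \<longleftrightarrow> x \<in> U' n"
  shows "x \<in> denote U c \<longleftrightarrow> x \<in> denote U' c"
  using assms by (induction c) auto

lemma denote_borel:
  assumes "\<And>n. U n \<in> sets borel"
  shows "denote U c \<in> sets borel"
proof (induction c)
  case (Node c)
  then have "(\<Union>i. denote U (c i)) \<in> sets borel" by blast
  then show ?case unfolding denote.simps by (rule borel_comp)
qed (simp add: assms)

text \<open>Induction over the generated sigma-algebra. All topological information sits in
  \<open>U\<close>; the code \<open>c\<close> is combinatorial, and its type does not depend on the
  space.\<close>

lemma borel_imp_denote:
  fixes S :: "'x::topological_space set"
  assumes "S \<in> sets borel"
  shows "\<exists>U c. (\<forall>n. open (U n)) \<and> S = denote U c"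
proof -
  have "S \<in> sigma_sets UNIV {S. open S}"
    using assms by (simp add: borel_def)
  then show ?thesis
  proof induction
    case (Basic S)
    then show ?case by (intro exI[of _ "\<lambda>_. S"] exI[of _ "Gen 0"]) auto
  next
    case Empty
    show ?case by (intro exI[of _ "\<lambda>_. {}"] exI[of _ "Gen 0"]) auto
  next
    case (Compl S)
    then obtain U c where "\<forall>n. open (U n)" "S = denote U c" by blast
    then show ?case by (intro exI[of _ U] exI[of _ "Node (\<lambda>_. c)"]) auto
  next
    case (Union S)
    then obtain U c where U: "\<And>i n. open (U i n)" and S: "\<And>i. S i = denote (U i) (c i)"
      by metis
    \<comment> \<open>Interleaves the generators of all \<open>S i\<close>. In the code of the union
      below, the outer \<open>Node\<close> with constant argument undoes the complement taken by the
      inner one.\<close>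
    define W where "W k = (case prod_decode k of (i, n) \<Rightarrow> U i n)" for k
    have "denote W (rename (\<lambda>n. prod_encode (i, n)) (c i)) = S i" for i
      unfolding denote_rename S by (simp add: W_def comp_def)
    then have "(\<Union>i. S i)
        = denote W (Node (\<lambda>_. Node (\<lambda>i. rename (\<lambda>n. prod_encode (i, n)) (c i))))"
      by simp
    moreover have "\<forall>n. open (W n)" by (auto simp: W_def U split: prod.split)
    ultimately show ?case by blast
  qed
qed

text \<open>Records the tree as the set of its paths from the root with the label found there: 0 at
  an inner node, \<open>Suc n\<close> at a leaf \<open>Gen n\<close>.\<close>

primrec labels :: "borel_code \<Rightarrow> (nat list \<times> nat) set" where
  "labels (Gen n) = {([], Suc n)}"
| "labels (Node c) = insert ([], 0) (\<Union>i. (\<lambda>(p, m). (i # p, m)) ` labels (c i))"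

lemma labels_inject: "labels c = labels d \<Longrightarrow> c = d"
proof (induction c arbitrary: d)
  case (Gen n)
  then show ?case by (cases d) auto
next
  case (Node c)
  show ?case
  proof (cases d)
    case (Gen n)
    then show ?thesis using Node.prems by auto
  next
    case (Node d')
    \<comment> \<open>Subtree \<open>i\<close> is recovered by stripping the leading
      \<open>i\<close> from the paths.\<close>
    have *: "labels (f i) = {(p, m). (i # p, m) \<in> labels (Node f)}" for f i by auto
    have "labels (c i) = labels (d' i)" for i
      unfolding *[of c i] *[of d' i] using Node.prems Node by simp
    then have "c i = d' i" for i using Node.IH by blast
    then show ?thesis using Node by auto
  qed
qed

text \<open>Label sets are subsets of the countable type \<open>nat list \<times> nat\<close>, hence
  amount to sets of naturals.\<close>

lemma ex_inj_borel_code: "\<exists>b :: borel_code \<Rightarrow> nat set. inj b"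
proof
  show "inj (\<lambda>c. to_nat ` labels c)"
    by (intro injI) (metis inj_image_eq_iff inj_to_nat labels_inject)
qed

section \<open>Diagonal unions of two disjoint families\<close>

text \<open>For x in \<open>V i\<close> and \<open>S j\<close>, equality of i and j means that
  \<open>b i\<close> and \<open>b j\<close> agree at every k. Agreement at one k involves only
  unions within each family, which are Borel, and there are countably many k.\<close>

lemma borel_diagonal_continuum:
  fixes V S :: "'j \<Rightarrow> 'x::topological_space set"
  assumes V: "\<And>j. open (V j)" "disjoint_family V" and S: "disjoint_family S"
    and additive: "\<And>K. (\<Union>j\<in>K. S j) \<in> sets borel"
    and b: "inj_on (b :: 'j \<Rightarrow> nat set) J"
  shows "(\<Union>j\<in>J. V j \<inter> S j) \<in> sets borel"
proof -
  \<comment> \<open>The bits of the injective index \<open>b\<close> are compared one by one.\<close>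
  define H where "H k = {j\<in>J. k \<in> b j}" for k
  define L where "L k = {j\<in>J. k \<notin> b j}" for k
  have VO: "(\<Union>j\<in>K. V j) \<in> sets borel" for K
    by (intro borel_open open_UN ballI V)
  have VD: "j = k" if "x \<in> V j" "x \<in> V k" for j k x
    using that V(2) unfolding disjoint_family_on_def by blast
  have SD: "j = k" if "x \<in> S j" "x \<in> S k" for j k x
    using that S unfolding disjoint_family_on_def by blast
  have "(\<Union>j\<in>J. V j \<inter> S j) =
    (\<Inter>k. ((\<Union>j\<in>H k. V j) \<inter> (\<Union>j\<in>H k. S j)) \<union> ((\<Union>j\<in>L k. V j) \<inter> (\<Union>j\<in>L k. S j)))"
    (is "?L = (\<Inter>k. ?R k)")
  proof (intro equalityI subsetI)
    fix x assume "x \<in> ?L"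
    then show "x \<in> (\<Inter>k. ?R k)" unfolding H_def L_def by blast
  next
    fix x assume x: "x \<in> (\<Inter>k. ?R k)"
    \<comment> \<open>One bit already supplies candidate indices; the other bits then force them to
      agree.\<close>
    then have "x \<in> ?R 0" by blast
    then obtain i j where ij: "i \<in> J" "j \<in> J" "x \<in> V i" "x \<in> S j"
      unfolding H_def L_def by blast
    have "k \<in> b i \<longleftrightarrow> k \<in> b j" for k
    proof -
      have "x \<in> ?R k" using x by blast
      then show ?thesis using VD[OF ij(3)] SD[OF ij(4)] unfolding H_def L_def by blast
    qed
    then have "i = j" using b ij by (meson inj_onD set_eqI)
    then show "x \<in> ?L" using ij by blast
  qed
  moreover have "?R k \<in> sets borel" for k
    by (intro sets.Un sets.Int VO additive)
  ultimately show ?thesis by auto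
qed

text \<open>Once all pieces share a code \<open>c\<close>, their generators can be glued along the
  disjoint open sets \<open>V j\<close>, and \<open>c\<close> applied to the glued generators
  describes all pieces at once.\<close>

lemma borel_diagonal:
  fixes V S :: "'j \<Rightarrow> 'x::topological_space set"
  assumes V: "\<And>j. open (V j)" "disjoint_family V" and S: "disjoint_family S"
    and additive: "\<And>K. (\<Union>j\<in>K. S j) \<in> sets borel"
  shows "(\<Union>j. V j \<inter> S j) \<in> sets borel"
proof -
  have VD: "j = k" if "x \<in> V j" "x \<in> V k" for j k x
    using that V(2) unfolding disjoint_family_on_def by blast
  have "\<exists>c. \<forall>j. \<exists>U. (\<forall>n. open (U n)) \<and> V j \<inter> S j = V j \<inter> denote U c"
  proof (rule ccontr)
    \<comment> \<open>If every code fails for some index, the family of these indices has size at most continuum,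
      and the code of its union is a code for each of its members.\<close>
    assume "\<not> ?thesis"
    then obtain f where f: "\<And>c U. (\<forall>n. open (U n)) \<Longrightarrow> V (f c) \<inter> S (f c) \<noteq> V (f c) \<inter> denote U c"
      by metis
    obtain b :: "borel_code \<Rightarrow> nat set" where "inj b" using ex_inj_borel_code by blast
    \<comment> \<open>Each member of \<open>range f\<close> is labelled by a code that it defeats,
      and thereby by a set of naturals.\<close>
    then have "inj_on (b \<circ> inv f) (range f)"
      by (intro comp_inj_on inj_on_inv_into) (auto intro: inj_on_subset)
    then have "(\<Union>j\<in>range f. V j \<inter> S j) \<in> sets borel"
      using borel_diagonal_continuum[OF V S additive] by blast
    from borel_imp_denote[OF this] obtain U c
      where U: "\<forall>n. open (U n)" and eq: "(\<Union>j\<in>range f. V j \<inter> S j) = denote U c"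
      by (elim exE conjE)
    have "x \<in> S (f c)" if "x \<in> V (f c)" "x \<in> V j" "x \<in> S j" for x j
      using that(3) VD[OF that(1,2)] by simp
    then have "V (f c) \<inter> S (f c) = V (f c) \<inter> (\<Union>j\<in>range f. V j \<inter> S j)"
      by blast
    then show False using f[OF U] eq by metis
  qed
  then obtain c U where U: "\<And>j n. open (U j n)"
    and eq: "\<And>j. V j \<inter> S j = V j \<inter> denote (U j) c"
    by metis
  \<comment> \<open>Inside \<open>V j\<close> the set \<open>W n\<close> coincides with
    \<open>U j n\<close>, since the \<open>V j\<close> are disjoint.\<close>
  define W where "W n = (\<Union>j. V j \<inter> U j n)" for n
  have "x \<in> denote (U j) c \<longleftrightarrow> x \<in> denote W c" if "x \<in> V j" for x j
  proof (rule mem_denote_cong)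
    show "x \<in> U j n \<longleftrightarrow> x \<in> W n" for n
      unfolding W_def using that VD[OF that] by blast
  qed
  then have "(\<Union>j. V j \<inter> S j) = (\<Union>j. V j) \<inter> denote W c"
    unfolding eq by blast
  moreover have "denote W c \<in> sets borel"
    unfolding W_def by (intro denote_borel borel_open open_UN ballI open_Int U V)
  moreover have "(\<Union>j. V j) \<in> sets borel" using V by (intro borel_open) auto
  ultimately show ?thesis by simp
qed

section \<open>Measurability along a policy\<close>

text \<open>By compactness finitely many small sets \<open>B n a\<close> cover
  \<open>\<Gamma> x\<close>, and by upper hemicontinuity the same list serves near x. After refining
  these neighbourhoods into disjoint layers, a position in the list determines \<open>a\<close> from
  the state, and \<open>borel_diagonal\<close> applies. The factor 2 pays for replacing
  \<open>s x\<close> by the centre \<open>a\<close>.\<close>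

lemma graph_approx:
  fixes s :: "'x::metric_space \<Rightarrow> 'a::metric_space"
  assumes s: "s \<in> borel_measurable borel" "\<And>x. s x \<in> \<Gamma> x"
    and \<Gamma>: "\<And>x. compact (\<Gamma> x)" "upper_hemicont \<Gamma>"
    and Z: "open Z" and \<epsilon>: "\<epsilon> > 0"
  shows "\<exists>R\<in>sets borel. {x. ball x \<epsilon> \<times> ball (s x) (2 * \<epsilon>) \<subseteq> Z} \<subseteq> R \<and> R \<subseteq> {x. (x, s x) \<in> Z}"
proof -
  have "(\<Union>a. ball a \<epsilon>) = (UNIV :: 'a set)" using \<epsilon> by auto
  then obtain B :: "nat \<Rightarrow> 'a \<Rightarrow> 'a set" where B: "\<And>n a. open (B n a)" "\<And>n a. B n a \<subseteq> ball a \<epsilon>"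
      "\<And>n. disjoint_family (B n)" "(\<Union>n. \<Union>a. B n a) = UNIV"
    using sigma_disjoint_refinement[of "\<lambda>a::'a. ball a \<epsilon>"] by auto
  have "\<exists>F. \<Gamma> x \<subseteq> (\<Union>(n, a)\<in>set F. B n a)" for x
  proof -
    have "\<Gamma> x \<subseteq> (\<Union>p\<in>UNIV. case p of (n, a) \<Rightarrow> B n a)"
    proof
      fix y
      obtain n a where "y \<in> B n a" using B(4) by blast
      then show "y \<in> (\<Union>p\<in>UNIV. case p of (n, a) \<Rightarrow> B n a)" by auto
    qed
    then obtain F where "finite F" "\<Gamma> x \<subseteq> (\<Union>p\<in>F. case p of (n, a) \<Rightarrow> B n a)"
      using compactE_image[OF \<Gamma>(1), of UNIV "\<lambda>p. case p of (n, a) \<Rightarrow> B n a" x] B(1)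
      by (metis (mono_tags, lifting) case_prod_beta)
    then show ?thesis using finite_list by metis
  qed
  then obtain F where F: "\<And>x. \<Gamma> x \<subseteq> (\<Union>(n, a)\<in>set (F x). B n a)" by metis
  have "\<exists>C. open C \<and> x \<in> C \<and> (\<forall>y\<in>C. \<Gamma> y \<subseteq> (\<Union>(n, a)\<in>set (F x). B n a))" for x
    using \<Gamma>(2) F[of x] B(1) unfolding upper_hemicont_def by (simp add: open_UN case_prod_beta)
  then obtain C where C: "\<And>x. open (C x)" "\<And>x. x \<in> C x"
      "\<And>x y. y \<in> C x \<Longrightarrow> \<Gamma> y \<subseteq> (\<Union>(n, a)\<in>set (F x). B n a)"
    by metis
  have "(\<Union>x. C x) = UNIV" using C(2) by auto
  then obtain D :: "nat \<Rightarrow> 'x \<Rightarrow> 'x set" where D: "\<And>n i. open (D n i)" "\<And>n i. D n i \<subseteq> C i"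
      "\<And>n. disjoint_family (D n)" "(\<Union>n. \<Union>i. D n i) = UNIV"
    using sigma_disjoint_refinement[of C] C(1) by metis
  \<comment> \<open>With layer \<open>m\<close>, position \<open>k\<close> and \<open>n\<close>
    fixed, a state lies in at most one \<open>D m i\<close>, and \<open>a\<close> is read off from
    \<open>F i ! k\<close>; so the family is disjoint in \<open>a\<close>.\<close>
  define V where "V m k n a = (\<Union>i\<in>{i. k < length (F i) \<and> F i ! k = (n, a)}. D m i)" for m k n a
  \<comment> \<open>States whose fibre of \<open>Z\<close> contains the whole ball about
    \<open>a\<close>; the interior makes this set open, so that arbitrary unions over
    \<open>a\<close> stay Borel.\<close>
  define W where "W a = interior {x. {x} \<times> ball a \<epsilon> \<subseteq> Z}" for a
  define E where "E m k n = (\<Union>a. V m k n a \<inter> s -` B n a)" for m k n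
  have V_open: "open (V m k n a)" for m k n a using D(1) by (auto simp: V_def)
  have D_eq: "i = i'" if "x \<in> D m i" "x \<in> D m i'" for x m i i'
    using that D(3)[of m] unfolding disjoint_family_on_def by blast
  have V_eq: "a = a'" if "x \<in> V m k n a" "x \<in> V m k n a'" for x m k n a a'
    using that unfolding V_def by (auto dest: D_eq)
  then have V_disj: "disjoint_family (V m k n)" for m k n
    unfolding disjoint_family_on_def by blast
  have E_borel: "E m k n \<in> sets borel" for m k n
    unfolding E_def
  proof (rule borel_diagonal[OF V_open V_disj])
    show "disjoint_family (\<lambda>a. s -` B n a)"
      using B(3)[of n] unfolding disjoint_family_on_def by blast
    show "(\<Union>a\<in>K. s -` B n a) \<in> sets borel" for K
    proof -
      have "open (\<Union>a\<in>K. B n a)" using B(1) by blast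
      then have "s -` (\<Union>a\<in>K. B n a) \<in> sets borel"
        using measurable_sets_borel[OF s(1)] by auto
      then show ?thesis by (simp add: vimage_UN)
    qed
  qed
  \<comment> \<open>\<open>E\<close> and the inner union each pick an index \<open>a\<close>;
    disjointness of \<open>V m k n\<close> makes the two equal, so \<open>W a\<close> tests the very
    ball containing \<open>s x\<close>.\<close>
  define R where "R = (\<Union>m k n. E m k n \<inter> (\<Union>a. V m k n a \<inter> W a))"
  show ?thesis
  proof (intro bexI conjI subsetI)
    have "(\<Union>a. V m k n a \<inter> W a) \<in> sets borel" for m k n
      unfolding W_def by (intro borel_open open_UN ballI open_Int V_open open_interior)
    then have "E m k n \<inter> (\<Union>a. V m k n a \<inter> W a) \<in> sets borel" for m k n
      using E_borel by blast
    then show "R \<in> sets borel"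
      unfolding R_def by (intro sets.countable_UN'' countableI_type)
  next
    fix x assume "x \<in> R"
    then obtain m k n a a' where x: "x \<in> V m k n a" "s x \<in> B n a" "x \<in> V m k n a'" "x \<in> W a'"
      unfolding R_def E_def by blast
    then have "a = a'" using V_eq[of x m k n a a'] by simp
    moreover have "{x} \<times> ball a' \<epsilon> \<subseteq> Z" using x(4) interior_subset unfolding W_def by blast
    ultimately show "x \<in> {x. (x, s x) \<in> Z}" using subsetD[OF B(2) x(2)] by auto
  next
    fix x assume "x \<in> {x. ball x \<epsilon> \<times> ball (s x) (2 * \<epsilon>) \<subseteq> Z}"
    then have x: "ball x \<epsilon> \<times> ball (s x) (2 * \<epsilon>) \<subseteq> Z" by simp
    obtain m i where mi: "x \<in> D m i" using D(4) by blast
    then have "s x \<in> (\<Union>(n, a)\<in>set (F i). B n a)"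
      using C(3)[of x i] D(2)[of m i] s(2)[of x] by (meson subsetD)
    then obtain n a where na: "(n, a) \<in> set (F i)" "s x \<in> B n a" by auto
    then obtain k where k: "k < length (F i)" "F i ! k = (n, a)" by (metis in_set_conv_nth)
    have xV: "x \<in> V m k n a" using mi k unfolding V_def by blast
    have "dist a (s x) < \<epsilon>" using subsetD[OF B(2) na(2)] by simp
    have "ball a \<epsilon> \<subseteq> ball (s x) (2 * \<epsilon>)"
    proof
      fix y assume "y \<in> ball a \<epsilon>"
      then show "y \<in> ball (s x) (2 * \<epsilon>)"
        using \<open>dist a (s x) < \<epsilon>\<close> dist_triangle3[of "s x" y a] by auto
    qed
    then have "{y} \<times> ball a \<epsilon> \<subseteq> Z" if "y \<in> ball x \<epsilon>" for y
      using x that by (intro order_trans[OF Sigma_mono x]) auto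
    then have "ball x \<epsilon> \<subseteq> {x. {x} \<times> ball a \<epsilon> \<subseteq> Z}" by blast
    then have "x \<in> W a"
      unfolding W_def using \<epsilon> by (meson centre_in_ball interiorI open_ball)
    then have "x \<in> E m k n \<inter> (\<Union>a. V m k n a \<inter> W a)"
      using xV na(2) unfolding E_def by blast
    then show "x \<in> R" unfolding R_def by blast
  qed
qed

text \<open>The preimage of an open set is exhausted by the states with room \<open>e n\<close>
  around their graph point, and \<open>graph_approx\<close> interpolates Borel sets. Measurability
  of both components alone would not suffice here, as without separability the Borel sets of the
  product may exceed the product sigma-algebra.\<close>

lemma graph_measurable:
  fixes s :: "'x::metric_space \<Rightarrow> 'a::metric_space"
  assumes s: "s \<in> borel_measurable borel" "\<And>x. s x \<in> \<Gamma> x"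
    and \<Gamma>: "\<And>x. compact (\<Gamma> x)" "upper_hemicont \<Gamma>"
  shows "(\<lambda>x. (x, s x)) \<in> borel_measurable borel"
proof (rule borel_measurableI)
  fix Z :: "('x \<times> 'a) set"
  assume Z: "open Z"
  define e where "e n = inverse (real (Suc n))" for n
  have "\<forall>n. \<exists>R. R \<in> sets borel \<and> {x. ball x (e n) \<times> ball (s x) (2 * e n) \<subseteq> Z} \<subseteq> R
      \<and> R \<subseteq> {x. (x, s x) \<in> Z}"
  proof
    fix n
    have "e n > 0" by (simp add: e_def)
    from graph_approx[OF s \<Gamma> Z this]
    show "\<exists>R. R \<in> sets borel \<and> {x. ball x (e n) \<times> ball (s x) (2 * e n) \<subseteq> Z} \<subseteq> R
      \<and> R \<subseteq> {x. (x, s x) \<in> Z}"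
      unfolding Bex_def .
  qed
  then obtain R where "\<forall>n. R n \<in> sets borel \<and> {x. ball x (e n) \<times> ball (s x) (2 * e n) \<subseteq> Z} \<subseteq> R n
      \<and> R n \<subseteq> {x. (x, s x) \<in> Z}"
    by (rule choice[THEN exE])
  then have R: "\<And>n. R n \<in> sets borel"
      "\<And>n x. ball x (e n) \<times> ball (s x) (2 * e n) \<subseteq> Z \<Longrightarrow> x \<in> R n"
      "\<And>n. R n \<subseteq> {x. (x, s x) \<in> Z}"
    by blast+
  have "\<exists>n. x \<in> R n" if x: "(x, s x) \<in> Z" for x
  proof -
    obtain X Y where XY: "open X" "open Y" "x \<in> X" "s x \<in> Y" "X \<times> Y \<subseteq> Z"
      using Z x by (auto elim!: open_prod_elim)
    then obtain d e' where de: "d > 0" "e' > 0" "ball x d \<subseteq> X" "ball (s x) e' \<subseteq> Y"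
      by (meson open_contains_ball)
    obtain n where n: "e n < min d (e' / 2)"
      using reals_Archimedean[of "min d (e' / 2)"] de unfolding e_def by auto
    have "ball x (e n) \<times> ball (s x) (2 * e n) \<subseteq> ball x d \<times> ball (s x) e'"
      using n by (intro Sigma_mono subset_ball) auto
    also have "\<dots> \<subseteq> Z" using de XY(5) by (meson Sigma_mono order_trans)
    finally have "x \<in> R n" by (rule R(2))
    then show ?thesis ..
  qed
  then have "{x. (x, s x) \<in> Z} = (\<Union>n. R n)" using R(3) by blast
  then show "(\<lambda>x. (x, s x)) -` Z \<inter> space borel \<in> sets borel"
    using R(1) by (simp add: vimage_def)
qed

section \<open>Bounded Borel functions and their integrals\<close>

lemma bX_bound: "f \<in> bX \<Longrightarrow> \<exists>C. \<forall>x. \<bar>f x\<bar> \<le> C"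
  by (auto simp: bX_def bounded_iff)

lemma bXI: "f \<in> borel_measurable borel \<Longrightarrow> (\<And>x. \<bar>f x\<bar> \<le> C) \<Longrightarrow> f \<in> bX"
  by (auto simp: bX_def bounded_iff)

lemma bX_measurable: "f \<in> bX \<Longrightarrow> f \<in> borel_measurable borel"
  by (simp add: bX_def)

lemma bX_const: "(\<lambda>_. c) \<in> bX"
  by (rule bXI[of _ "\<bar>c\<bar>"]) auto

lemma bX_add:
  assumes "f \<in> bX" "g \<in> bX"
  shows "(\<lambda>x. f x + g x) \<in> bX"
proof -
  obtain C D where "\<forall>x. \<bar>f x\<bar> \<le> C" "\<forall>x. \<bar>g x\<bar> \<le> D" using assms bX_bound by meson
  then have "\<bar>f x + g x\<bar> \<le> C + D" for x
    by (meson abs_triangle_ineq add_mono order_trans)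
  then show ?thesis by (rule bXI[rotated]) (intro borel_measurable_add bX_measurable assms)
qed

lemma bX_scale:
  assumes "f \<in> bX"
  shows "(\<lambda>x. c * f x) \<in> bX"
proof -
  obtain C where "\<forall>x. \<bar>f x\<bar> \<le> C" using assms bX_bound by meson
  then have "\<bar>c * f x\<bar> \<le> \<bar>c\<bar> * C" for x
    by (simp add: abs_mult mult_left_mono)
  then show ?thesis by (rule bXI[rotated]) (intro borel_measurable_times borel_measurable_const bX_measurable assms)
qed

lemma bX_diff: "f \<in> bX \<Longrightarrow> g \<in> bX \<Longrightarrow> (\<lambda>x. f x - g x) \<in> bX"
  using bX_add[of f "\<lambda>x. (-1) * g x"] bX_scale[of g "-1"] by simp

lemma bX_abs:
  assumes "f \<in> bX"
  shows "(\<lambda>x. \<bar>f x\<bar>) \<in> bX"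
proof -
  obtain C where "\<forall>x. \<bar>f x\<bar> \<le> C" using assms bX_bound by meson
  then have "\<bar>\<bar>f x\<bar>\<bar> \<le> C" for x by simp
  then show ?thesis by (rule bXI[rotated]) (intro borel_measurable_abs bX_measurable assms)
qed

lemma bX_max:
  assumes "f \<in> bX" "g \<in> bX"
  shows "(\<lambda>x. max (f x) (g x)) \<in> bX"
proof -
  obtain C D where "\<forall>x. \<bar>f x\<bar> \<le> C" "\<forall>x. \<bar>g x\<bar> \<le> D" using assms bX_bound by meson
  then have "\<bar>max (f x) (g x)\<bar> \<le> max C D" for x
    by (simp add: max_def) (smt (verit))
  then show ?thesis by (rule bXI[rotated]) (intro borel_measurable_max bX_measurable assms)
qed

lemma integrable_bX:
  assumes "prob_space M" "sets M = sets borel" "f \<in> bX"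
  shows "integrable M f"
proof -
  interpret prob_space M by fact
  obtain C where "\<forall>x. \<bar>f x\<bar> \<le> C" using assms bX_bound by meson
  moreover have "f \<in> borel_measurable M"
    using bX_measurable[OF assms(3)] assms(2) measurable_cong_sets by blast
  ultimately show ?thesis by (intro integrable_const_bound[of _ C]) auto
qed

lemma integral_mono_bX:
  assumes "prob_space M" "sets M = sets borel" "f \<in> bX" "g \<in> bX" "\<And>x. f x \<le> g x"
  shows "integral\<^sup>L M f \<le> integral\<^sup>L M g"
  using assms by (intro integral_mono integrable_bX)

text \<open>These bounded continuous functions decrease to the indicator of the closed set, so
  dominated convergence applies. The result transfers the continuity assumption on the kernel to
  measures of sets.\<close>

lemma measure_closed_eq_lim:
  fixes F :: "'x::metric_space set"
  assumes M: "prob_space M" "sets M = sets borel" and F: "closed F" "F \<noteq> {}"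
  shows "(\<lambda>n. \<integral>y. max 0 (1 - real n * infdist y F) \<partial>M) \<longlonglongrightarrow> measure M F"
proof -
  interpret prob_space M by fact
  have meas: "f \<in> borel_measurable M" if "f \<in> borel_measurable borel" for f :: "'x \<Rightarrow> real"
    using that M(2) measurable_cong_sets by blast
  have FM: "F \<in> sets M" using F M(2) by auto
  have "(\<lambda>n. \<integral>y. max 0 (1 - real n * infdist y F) \<partial>M) \<longlonglongrightarrow> (\<integral>y. indicator F y \<partial>M)"
  proof (rule integral_dominated_convergence[where w = "\<lambda>_. 1"])
    show "(\<lambda>y. max 0 (1 - real n * infdist y F)) \<in> borel_measurable M" for n
      by (intro meas borel_measurable_continuous_onI continuous_intros)
    show "AE y in M. (\<lambda>n. max 0 (1 - real n * infdist y F)) \<longlonglongrightarrow> indicator F y"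
    proof (rule AE_I2)
      fix y
      show "(\<lambda>n. max 0 (1 - real n * infdist y F)) \<longlonglongrightarrow> indicator F y"
      proof (cases "y \<in> F")
        case True
        then show ?thesis by simp
      next
        case False
        then have pos: "infdist y F > 0" using F infdist_pos_not_in_closed by blast
        then obtain N where N: "real N * infdist y F > 1"
          using reals_Archimedean3 by blast
        have "max 0 (1 - real n * infdist y F) = 0" if "n \<ge> N" for n
        proof -
          have "real N * infdist y F \<le> real n * infdist y F"
            using that pos by (intro mult_right_mono) auto
          then show ?thesis using N by simp
        qed
        then show ?thesis using False
          by (intro tendsto_eventually) (auto simp: eventually_sequentially)
      qed
    qed
    show "AE y in M. norm (max 0 (1 - real n * infdist y F)) \<le> 1" for n
      by (intro AE_I2) (auto simp: infdist_nonneg)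
  qed (use FM in auto)
  then show ?thesis using FM by simp
qed

section \<open>Policy improvement\<close>

locale mdp =
  fixes r :: "'x::metric_space \<times> 'a::metric_space \<Rightarrow> real"
    and \<Gamma> :: "'x \<Rightarrow> 'a set" and \<beta> :: real and P :: "'x \<Rightarrow> 'a \<Rightarrow> 'x measure"
  assumes is_MDP: "is_MDP r \<Gamma> \<beta> P"
begin

abbreviation K :: "('x \<Rightarrow> 'a) \<Rightarrow> ('x \<Rightarrow> real) \<Rightarrow> 'x \<Rightarrow> real" where
  "K s \<equiv> markov_op (P_pol P s)"

abbreviation v :: "('x \<Rightarrow> 'a) \<Rightarrow> 'x \<Rightarrow> real" where
  "v \<equiv> v_pol r \<beta> P"

text \<open>The policy operator of \<open>s\<close>, whose fixed point is
  \<open>v s\<close>.\<close>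

definition T :: "('x \<Rightarrow> 'a) \<Rightarrow> ('x \<Rightarrow> real) \<Rightarrow> 'x \<Rightarrow> real" where
  "T s w x = r_pol r s x + \<beta> * K s w x"

lemma beta: "0 < \<beta>" "\<beta> < 1"
  using is_MDP by (auto simp: is_MDP_def)

section \<open>Markov operators of policies\<close>

lemma kernel:
  assumes "s \<in> policies \<Gamma>"
  shows "prob_space (P_pol P s x)" "sets (P_pol P s x) = sets borel"
  using is_MDP assms by (auto simp: is_MDP_def policies_def P_pol_def graph_corr_def)

lemma measurable_along_policy:
  fixes g :: "'x \<times> 'a \<Rightarrow> real"
  assumes s: "s \<in> policies \<Gamma>" and g: "continuous_on (graph_corr \<Gamma>) g"
  shows "(\<lambda>x. g (x, s x)) \<in> borel_measurable borel"
proof -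
  have "(\<lambda>x. (x, s x)) \<in> borel_measurable borel"
    using is_MDP s by (intro graph_measurable[of _ \<Gamma>]) (auto simp: is_MDP_def policies_def)
  then have "(\<lambda>x. (x, s x)) \<in> borel \<rightarrow>\<^sub>M restrict_space borel (graph_corr \<Gamma>)"
    using s by (intro measurable_restrict_space2) (auto simp: policies_def graph_corr_def)
  then show ?thesis
    using borel_measurable_continuous_on_restrict[OF g] by (rule measurable_compose)
qed

text \<open>Closed sets form an intersection-stable generator, and their measures are limits of
  integrals of functions in \<open>cbX\<close>, which are measurable along the policy.\<close>

lemma kernel_measurable:
  assumes s: "s \<in> policies \<Gamma>"
  shows "P_pol P s \<in> borel \<rightarrow>\<^sub>M subprob_algebra borel"
proof (rule measurable_subprob_algebra_generated[where G = "Collect closed" and \<Omega> = UNIV])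
  show "sets borel = sigma_sets UNIV (Collect closed :: 'x set set)"
    by (simp add: borel_eq_closed)
  show "Int_stable (Collect closed :: 'x set set)" by (auto simp: Int_stable_def)
  show "subprob_space (P_pol P s a)" for a
    using kernel(1)[OF s] prob_space_imp_subprob_space by blast
  have *: "(\<lambda>a. emeasure (P_pol P s a) F) \<in> borel_measurable borel" if F: "closed F" for F
  \<comment> \<open>\<open>infdist\<close> to the empty set is 0 by convention, which would turn the
    approximating functions into 1.\<close>
  proof (cases "F = {}")
    case False
    have "(\<lambda>a. measure (P_pol P s a) F) \<in> borel_measurable borel"
    proof (rule borel_measurable_LIMSEQ_real)
      show "(\<lambda>n. \<integral>y. max 0 (1 - real n * infdist y F) \<partial>P_pol P s a) \<longlonglongrightarrow> measure (P_pol P s a) F" for a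
        using measure_closed_eq_lim kernel[OF s] F False by blast
      show "(\<lambda>a. \<integral>y. max 0 (1 - real n * infdist y F) \<partial>P_pol P s a) \<in> borel_measurable borel" for n
      proof -
        have "(\<lambda>y. max 0 (1 - real n * infdist y F)) \<in> cbX"
          by (auto simp: cbX_def bounded_iff infdist_nonneg intro!: continuous_intros exI[of _ 1])
        then have "continuous_on (graph_corr \<Gamma>)
            (\<lambda>(x, a). \<integral>y. max 0 (1 - real n * infdist y F) \<partial>P x a)"
          using is_MDP unfolding is_MDP_def by blast
        from measurable_along_policy[OF s this] show ?thesis by (simp add: P_pol_def)
      qed
    qed
    then show ?thesis
      using kernel(1)[OF s] by (simp add: finite_measure.emeasure_eq_measure prob_space.finite_measure)
  qed simp
  then show "(\<lambda>a. emeasure (P_pol P s a) A) \<in> borel_measurable borel" if "A \<in> Collect closed" for A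
    using that by simp
  show "(\<lambda>a. emeasure (P_pol P s a) UNIV) \<in> borel_measurable borel" by (rule *) simp
qed (use kernel(2)[OF s] in auto)

lemma K_mono:
  assumes "s \<in> policies \<Gamma>" "f \<in> bX" "g \<in> bX" "\<And>x. f x \<le> g x"
  shows "K s f x \<le> K s g x"
  unfolding markov_op_def using assms kernel by (intro integral_mono_bX)

lemma K_const: "s \<in> policies \<Gamma> \<Longrightarrow> K s (\<lambda>_. c) x = c"
  using prob_space.prob_space[OF kernel(1)] by (simp add: markov_op_def)

lemma K_bound:
  assumes s: "s \<in> policies \<Gamma>" and f: "f \<in> bX" and C: "\<And>x. \<bar>f x\<bar> \<le> C"
  shows "\<bar>K s f x\<bar> \<le> C"
proof -
  have "f x \<le> C" "- C \<le> f x" for x using C[of x] by auto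
  then have "K s f x \<le> C" "- C \<le> K s f x"
    using K_mono[OF s f bX_const[of C], of x] K_mono[OF s bX_const[of "- C"] f, of x]
    by (auto simp: K_const[OF s])
  then show ?thesis by simp
qed

lemma K_bX:
  assumes s: "s \<in> policies \<Gamma>" and f: "f \<in> bX"
  shows "K s f \<in> bX"
proof -
  obtain C where C: "\<And>x. \<bar>f x\<bar> \<le> C" using bX_bound[OF f] by blast
  have "K s f \<in> borel_measurable borel"
    unfolding markov_op_def
    using measurable_compose[OF kernel_measurable[OF s]
        integral_measurable_subprob_algebra[OF bX_measurable[OF f]]] .
  then show ?thesis using K_bound[OF s f C] by (rule bXI)
qed

lemma K_pow_bX: "s \<in> policies \<Gamma> \<Longrightarrow> f \<in> bX \<Longrightarrow> (K s ^^ m) f \<in> bX"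
  by (induction m) (simp_all add: K_bX)

lemma K_add:
  assumes "s \<in> policies \<Gamma>" "f \<in> bX" "g \<in> bX"
  shows "K s (\<lambda>x. f x + g x) = (\<lambda>x. K s f x + K s g x)"
  unfolding markov_op_def using assms
  by (intro ext Bochner_Integration.integral_add integrable_bX kernel)

lemma K_scale: "K s (\<lambda>x. c * f x) = (\<lambda>x. c * K s f x)"
  by (simp add: markov_op_def)

lemma K_diff:
  assumes "s \<in> policies \<Gamma>" "f \<in> bX" "g \<in> bX"
  shows "K s (\<lambda>x. f x - g x) = (\<lambda>x. K s f x - K s g x)"
  unfolding markov_op_def using assms
  by (intro ext Bochner_Integration.integral_diff integrable_bX kernel)

lemma K_pow_mono:
  assumes "s \<in> policies \<Gamma>" "f \<in> bX" "g \<in> bX" "\<And>x. f x \<le> g x"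
  shows "(K s ^^ m) f x \<le> (K s ^^ m) g x"
proof (induction m arbitrary: x)
  case (Suc m)
  then show ?case using K_mono[OF assms(1) K_pow_bX K_pow_bX] assms by simp
qed (simp add: assms)

lemma K_pow_zero: "(K s ^^ m) (\<lambda>_. 0) = (\<lambda>_. 0)"
  by (induction m) (auto simp: markov_op_def)

lemma K_pow_add:
  assumes "s \<in> policies \<Gamma>" "f \<in> bX" "g \<in> bX"
  shows "(K s ^^ m) (\<lambda>x. f x + g x) = (\<lambda>x. (K s ^^ m) f x + (K s ^^ m) g x)"
  using assms by (induction m) (simp_all add: K_add K_pow_bX)

lemma K_pow_scale: "(K s ^^ m) (\<lambda>x. c * f x) = (\<lambda>x. c * (K s ^^ m) f x)"
  by (induction m) (simp_all add: K_scale)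

lemma abs_K_le: "\<bar>K s f x\<bar> \<le> K s (\<lambda>x. \<bar>f x\<bar>) x"
  unfolding markov_op_def by (rule integral_abs_bound)

section \<open>Value functions as discounted series\<close>

lemma r_bound: "\<exists>C. \<forall>s\<in>policies \<Gamma>. \<forall>x. \<bar>r_pol r s x\<bar> \<le> C"
proof -
  obtain C where C: "\<forall>p\<in>graph_corr \<Gamma>. \<bar>r p\<bar> \<le> C"
    using is_MDP by (auto simp: is_MDP_def bounded_iff)
  then show ?thesis
    by (intro exI[of _ C]) (auto simp: r_pol_def policies_def graph_corr_def)
qed

lemma r_bX:
  assumes s: "s \<in> policies \<Gamma>"
  shows "r_pol r s \<in> bX"
proof -
  obtain C where "\<And>x. \<bar>r_pol r s x\<bar> \<le> C" using r_bound s by blast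
  moreover have "r_pol r s \<in> borel_measurable borel"
    unfolding r_pol_def using is_MDP
    by (intro measurable_along_policy[OF s]) (simp add: is_MDP_def)
  ultimately show ?thesis by (intro bXI)
qed

lemma K_pow_bound:
  assumes s: "s \<in> policies \<Gamma>" and f: "f \<in> bX" and C: "\<And>x. \<bar>f x\<bar> \<le> C"
  shows "\<bar>(K s ^^ m) f x\<bar> \<le> C"
proof (induction m arbitrary: x)
  case (Suc m)
  then show ?case using K_bound[OF s K_pow_bX[OF s f]] by simp
qed (simp add: C)

lemma geometric_bound:
  assumes C: "\<And>t. \<bar>a t\<bar> \<le> C"
  shows "summable (\<lambda>t. \<bar>\<beta> ^ t * a t\<bar>)" "\<bar>\<Sum>t. \<beta> ^ t * a t\<bar> \<le> C / (1 - \<beta>)"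
proof -
  have le: "\<bar>\<beta> ^ t * a t\<bar> \<le> \<beta> ^ t * C" for t
    using C[of t] beta by (simp add: abs_mult mult_left_mono)
  have geo: "summable (\<lambda>t. \<beta> ^ t * C)" using beta by (intro summable_mult2 summable_geometric) auto
  show *: "summable (\<lambda>t. \<bar>\<beta> ^ t * a t\<bar>)"
    by (rule summable_comparison_test[OF _ geo]) (use le in auto)
  have "\<bar>\<Sum>t. \<beta> ^ t * a t\<bar> \<le> (\<Sum>t. \<bar>\<beta> ^ t * a t\<bar>)" by (rule summable_rabs[OF *])
  also have "\<dots> \<le> (\<Sum>t. \<beta> ^ t * C)" by (rule suminf_le[OF le * geo])
  also have "\<dots> = (\<Sum>t. \<beta> ^ t) * C"
    using beta by (intro suminf_mult2[symmetric] summable_geometric) auto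
  also have "\<dots> = C / (1 - \<beta>)" using beta by (simp add: suminf_geometric)
  finally show "\<bar>\<Sum>t. \<beta> ^ t * a t\<bar> \<le> C / (1 - \<beta>)" .
qed

text \<open>Uniformity over policies makes the real supremum in \<open>v_star\<close> that of a
  bounded set.\<close>

lemma v_bound: "\<exists>C. \<forall>s\<in>policies \<Gamma>. \<forall>x. \<bar>v s x\<bar> \<le> C"
proof -
  obtain C where C: "\<And>s x. s \<in> policies \<Gamma> \<Longrightarrow> \<bar>r_pol r s x\<bar> \<le> C" using r_bound by blast
  have "\<bar>v s x\<bar> \<le> C / (1 - \<beta>)" if s: "s \<in> policies \<Gamma>" for s x
    unfolding v_pol_def by (intro geometric_bound K_pow_bound s r_bX C)
  then show ?thesis by blast
qed

lemma v_bX: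
  assumes s: "s \<in> policies \<Gamma>"
  shows "v s \<in> bX"
proof -
  obtain C where "\<And>x. \<bar>v s x\<bar> \<le> C" using v_bound s by blast
  moreover have "v s \<in> borel_measurable borel"
    unfolding v_pol_def
    by (intro borel_measurable_suminf borel_measurable_times borel_measurable_const
        bX_measurable K_pow_bX s r_bX)
  ultimately show ?thesis by (intro bXI)
qed

text \<open>Splitting off the term t = 0 leaves \<beta> times the image of the series under
  \<open>K s\<close>, once integral and sum are exchanged.\<close>

lemma v_fixed_point:
  assumes s: "s \<in> policies \<Gamma>"
  shows "v s x = T s (v s) x"
proof -
  obtain C where C: "\<And>x. \<bar>r_pol r s x\<bar> \<le> C" using r_bound s by blast
  define a where "a t = (K s ^^ t) (r_pol r s)" for t
  have a_bX: "a t \<in> bX" for t unfolding a_def by (intro K_pow_bX s r_bX)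
  have a_bd: "\<bar>a t y\<bar> \<le> C" for t y unfolding a_def by (intro K_pow_bound s r_bX C)
  have K_a: "K s (a t) = a (Suc t)" for t by (simp add: a_def)
  have sm: "summable (\<lambda>t. \<bar>\<beta> ^ t * a t y\<bar>)" for y by (rule geometric_bound(1)[OF a_bd])
  have v_eq: "v s = (\<lambda>y. \<Sum>t. \<beta> ^ t * a t y)" by (simp add: v_pol_def a_def)
  let ?M = "P_pol P s x"
  have int: "integrable ?M (\<lambda>y. \<beta> ^ t * a t y)" for t
    by (intro integrable_bX kernel s bX_scale a_bX)
  \<comment> \<open>Domination by a geometric series justifies the exchange.\<close>
  have "summable (\<lambda>t. \<integral>y. norm (\<beta> ^ t * a t y) \<partial>?M)"
  proof -
    have "(\<integral>y. norm (\<beta> ^ t * a t y) \<partial>?M) = \<beta> ^ t * K s (\<lambda>y. \<bar>a t y\<bar>) x" for t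
      using beta by (simp add: markov_op_def abs_mult)
    moreover have "\<bar>K s (\<lambda>y. \<bar>a t y\<bar>) x\<bar> \<le> C" for t
      using a_bd by (intro K_bound s bX_abs a_bX) simp
    ultimately show ?thesis
      using geometric_bound(1)[of "\<lambda>t. K s (\<lambda>y. \<bar>a t y\<bar>) x" C]
      by (auto dest: summable_rabs_cancel)
  qed
  then have "(\<integral>y. (\<Sum>t. \<beta> ^ t * a t y) \<partial>?M) = (\<Sum>t. \<integral>y. \<beta> ^ t * a t y \<partial>?M)"
    using sm by (intro integral_suminf int) auto
  then have "K s (v s) x = (\<Sum>t. \<beta> ^ t * a (Suc t) x)"
    unfolding v_eq by (simp add: markov_op_def K_a[symmetric])
  then have "\<beta> * K s (v s) x = (\<Sum>t. \<beta> ^ Suc t * a (Suc t) x)"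
    using summable_rabs_cancel[OF geometric_bound(1)[of "\<lambda>t. a (Suc t) x" C]] a_bd
    by (simp add: suminf_mult[symmetric] mult.assoc)
  moreover have "v s x = a 0 x + (\<Sum>t. \<beta> ^ Suc t * a (Suc t) x)"
    unfolding v_eq using suminf_split_head[OF summable_rabs_cancel[OF sm[of x]]] by simp
  ultimately show ?thesis by (simp add: T_def a_def)
qed

lemma T_mono:
  assumes "s \<in> policies \<Gamma>" "f \<in> bX" "g \<in> bX" "\<And>x. f x \<le> g x"
  shows "T s f x \<le> T s g x"
  using K_mono[OF assms] beta by (simp add: T_def)

lemma T_bX: "s \<in> policies \<Gamma> \<Longrightarrow> f \<in> bX \<Longrightarrow> T s f \<in> bX"
  unfolding T_def by (intro bX_add bX_scale r_bX K_bX)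

section \<open>Comparison principle and switching of policies\<close>

text \<open>The difference \<open>d\<close> of \<open>w\<close> and \<open>v s\<close> satisfies
  \<open>d x \<le> \<beta> * K s d x\<close>; iteration bounds it by \<open>\<beta> ^ n * C\<close>,
  which tends to 0.\<close>

lemma le_v_if_le_T:
  assumes s: "s \<in> policies \<Gamma>" and w: "w \<in> bX" and le: "\<And>x. w x \<le> T s w x"
  shows "w x \<le> v s x"
proof -
  define d where "d x = w x - v s x" for x
  have d: "d \<in> bX" unfolding d_def by (intro bX_diff w v_bX s)
  then obtain C where C: "\<And>x. \<bar>d x\<bar> \<le> C" using bX_bound by blast
  have step: "d x \<le> \<beta> * K s d x" for x
  proof -
    have "d x \<le> T s w x - T s (v s) x" unfolding d_def using le[of x] v_fixed_point[OF s, of x] by simp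
    also have "\<dots> = \<beta> * K s d x"
      unfolding d_def K_diff[OF s w v_bX[OF s]] by (simp add: T_def algebra_simps)
    finally show ?thesis .
  qed
  have "d x \<le> \<beta> ^ n * C" for n x
  proof (induction n arbitrary: x)
    case 0
    show ?case using C[of x] by simp
  next
    case (Suc n)
    have "d x \<le> \<beta> * K s d x" by (rule step)
    also have "K s d x \<le> K s (\<lambda>_. \<beta> ^ n * C) x" by (intro K_mono s d bX_const Suc)
    finally show ?case using beta by (simp add: K_const[OF s] mult.assoc mult_left_mono)
  qed
  moreover have "(\<lambda>n. \<beta> ^ n * C) \<longlonglongrightarrow> 0 * C"
    using beta by (intro tendsto_mult LIMSEQ_power_zero) auto
  ultimately have "d x \<le> 0" using LIMSEQ_le_const[of "\<lambda>n. \<beta> ^ n * C" "0 * C" "d x"] by auto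
  then show ?thesis by (simp add: d_def)
qed

text \<open>\<open>T u w x\<close> depends on \<open>u\<close> only through \<open>u x\<close>, so
  two policies may be pasted along a Borel set of states.\<close>

lemma switch_policy:
  assumes "s \<in> policies \<Gamma>" "s' \<in> policies \<Gamma>" "f \<in> bX" "g \<in> bX"
  obtains u where "u \<in> policies \<Gamma>" "\<And>w x. T u w x = (if g x < f x then T s w x else T s' w x)"
proof
  define u where "u = (\<lambda>x. if x \<in> {x. g x < f x} then s x else s' x)"
  have "{x \<in> space borel. g x < f x} \<in> sets borel"
    using assms by (intro borel_measurable_less bX_measurable)
  then show "u \<in> policies \<Gamma>"
    using assms measurable_If_set[of s borel borel s' "{x. g x < f x}"]
    by (auto simp: policies_def u_def)
  show "T u w x = (if g x < f x then T s w x else T s' w x)" for w x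
    by (simp add: T_def r_pol_def markov_op_def P_pol_def u_def)
qed

text \<open>Let \<open>u\<close> follow whichever policy has the larger value at the current state.
  By monotonicity the maximum \<open>w\<close> of the two values satisfies
  \<open>w x \<le> T u w x\<close>, and comparison applies.\<close>

lemma policy_max:
  assumes s: "s \<in> policies \<Gamma>" and s': "s' \<in> policies \<Gamma>"
  obtains u where "u \<in> policies \<Gamma>" "\<And>x. v s x \<le> v u x" "\<And>x. v s' x \<le> v u x"
proof -
  obtain u where u: "u \<in> policies \<Gamma>"
    "\<And>w x. T u w x = (if v s' x < v s x then T s w x else T s' w x)"
    using switch_policy[OF s s' v_bX[OF s] v_bX[OF s']] by blast
  let ?w = "\<lambda>x. max (v s x) (v s' x)"
  have w: "?w \<in> bX" by (intro bX_max v_bX s s')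
  have "?w x \<le> T u ?w x" for x
    using T_mono[OF s v_bX[OF s] w, of x] T_mono[OF s' v_bX[OF s'] w, of x]
      v_fixed_point[OF s, of x] v_fixed_point[OF s', of x] by (auto simp: u(2))
  then have "?w x \<le> v u x" for x by (rule le_v_if_le_T[OF u(1) w])
  then show thesis using that[OF u(1)] by simp
qed

text \<open>Let \<open>u\<close> follow \<open>s'\<close> where one period of it before
  \<open>s\<close> strictly helps, and \<open>s\<close> elsewhere. Then \<open>T u (v s)\<close> is
  the maximum of \<open>v s\<close> and \<open>T s' (v s)\<close>.\<close>

lemma policy_improvement:
  assumes s: "s \<in> policies \<Gamma>" and s': "s' \<in> policies \<Gamma>"
  obtains u where "u \<in> policies \<Gamma>" "\<And>x. T s' (v s) x \<le> v u x"
proof -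
  obtain u where u: "u \<in> policies \<Gamma>"
    "\<And>w x. T u w x = (if v s x < T s' (v s) x then T s' w x else T s w x)"
    using switch_policy[OF s' s T_bX[OF s' v_bX[OF s]] v_bX[OF s]] by blast
  have Tu: "T u (v s) x = max (v s x) (T s' (v s) x)" for x
    using v_fixed_point[OF s, of x] by (simp add: u(2) max_def)
  have "v s x \<le> v u x" for x by (rule le_v_if_le_T[OF u(1) v_bX[OF s]]) (simp add: Tu)
  \<comment> \<open>One more application of \<open>T u\<close>, which fixes \<open>v u\<close>,
    upgrades the bound \<open>v s\<close> to \<open>T u (v s)\<close>.\<close>
  then have "T u (v s) x \<le> v u x" for x
    using T_mono[OF u(1) v_bX[OF s] v_bX[OF u(1)]] v_fixed_point[OF u(1)] by metis
  then show thesis using that[OF u(1)] by (simp add: Tu)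
qed

text \<open>Two images under \<open>T \<sigma>\<close> differ by \<open>\<beta> * K \<sigma>\<close>
  of the difference of the arguments, so each improvement by \<sigma> contributes one such
  factor.\<close>

lemma iterated_improvement:
  assumes \<sigma>: "\<sigma> \<in> policies \<Gamma>" and s: "s \<in> policies \<Gamma>"
  shows "\<exists>u\<in>policies \<Gamma>. \<forall>x. \<beta> ^ m * (K \<sigma> ^^ m) (\<lambda>x. v s x - v \<sigma> x) x \<le> v u x - v \<sigma> x"
proof (induction m)
  case 0
  show ?case using s by auto
next
  case (Suc m)
  let ?h = "\<lambda>x. v s x - v \<sigma> x"
  from Suc obtain u where u: "u \<in> policies \<Gamma>"
    and le: "\<And>x. \<beta> ^ m * (K \<sigma> ^^ m) ?h x \<le> v u x - v \<sigma> x" by blast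
  obtain u' where u': "u' \<in> policies \<Gamma>" "\<And>x. T \<sigma> (v u) x \<le> v u' x"
    using policy_improvement[OF u \<sigma>] by blast
  have "\<beta> ^ Suc m * (K \<sigma> ^^ Suc m) ?h x \<le> v u' x - v \<sigma> x" for x
  proof -
    have "\<beta> ^ Suc m * (K \<sigma> ^^ Suc m) ?h x = \<beta> * K \<sigma> (\<lambda>x. \<beta> ^ m * (K \<sigma> ^^ m) ?h x) x"
      by (simp add: K_scale)
    also have "\<dots> \<le> \<beta> * K \<sigma> (\<lambda>x. v u x - v \<sigma> x) x"
      using beta le by (intro mult_left_mono K_mono \<sigma> bX_scale K_pow_bX bX_diff v_bX s u) auto
    also have "\<dots> = T \<sigma> (v u) x - T \<sigma> (v \<sigma>) x"
      unfolding K_diff[OF \<sigma> v_bX[OF u] v_bX[OF \<sigma>]] by (simp add: T_def algebra_simps)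
    also have "\<dots> \<le> v u' x - v \<sigma> x"
      using u'(2)[of x] v_fixed_point[OF \<sigma>, of x] by simp
    finally show ?thesis .
  qed
  then show ?case using u'(1) by blast
qed

section \<open>The null ideal and global optimality\<close>

lemma null_ideal_invariant:
  assumes \<sigma>: "\<sigma> \<in> policies \<Gamma>" and \<rho>: "prob_space \<rho>" "sets \<rho> = sets borel"
  shows "invariant_ideal (K \<sigma>) {f\<in>bX. \<forall>m. (\<integral>x. (K \<sigma> ^^ m) (\<lambda>x. \<bar>f x\<bar>) x \<partial>\<rho>) = 0}"
    (is "invariant_ideal _ ?I")
proof -
  \<comment> \<open>Domination principle behind closure under sums, solidity and invariance.\<close>
  have mono: "g \<in> ?I" if g: "g \<in> bX" and f: "\<And>m. (\<integral>x. (K \<sigma> ^^ m) (f m) x \<partial>\<rho>) = 0"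
    "\<And>m. f m \<in> bX" and le: "\<And>m x. \<bar>g x\<bar> \<le> f m x" for f g
  proof -
    have "(\<integral>x. (K \<sigma> ^^ m) (\<lambda>x. \<bar>g x\<bar>) x \<partial>\<rho>) = 0" for m
    proof (rule antisym)
      show "(\<integral>x. (K \<sigma> ^^ m) (\<lambda>x. \<bar>g x\<bar>) x \<partial>\<rho>) \<le> 0"
        unfolding f(1)[of m, symmetric]
        by (intro integral_mono_bX \<rho> K_pow_bX K_pow_mono \<sigma> bX_abs g f le)
      have "0 \<le> (K \<sigma> ^^ m) (\<lambda>x. \<bar>g x\<bar>) x" for x
        using K_pow_mono[OF \<sigma> bX_const[of 0] bX_abs[OF g], of m x] by (simp add: K_pow_zero)
      then show "0 \<le> (\<integral>x. (K \<sigma> ^^ m) (\<lambda>x. \<bar>g x\<bar>) x \<partial>\<rho>)" by (rule Bochner_Integration.integral_nonneg)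
    qed
    then show ?thesis using g by simp
  qed
  show ?thesis
    unfolding invariant_ideal_def is_ideal_def
  proof (intro conjI ballI allI impI)
    show "?I \<subseteq> bX" by blast
    show "(\<lambda>x. 0) \<in> ?I" by (simp add: bX_const K_pow_zero)
  next
    fix f g assume fg: "f \<in> ?I" "g \<in> ?I"
    then have bX: "f \<in> bX" "g \<in> bX" by auto
    show "(\<lambda>x. f x + g x) \<in> ?I"
    proof (rule mono[where f = "\<lambda>_ x. \<bar>f x\<bar> + \<bar>g x\<bar>"])
      show "(\<integral>x. (K \<sigma> ^^ m) (\<lambda>x. \<bar>f x\<bar> + \<bar>g x\<bar>) x \<partial>\<rho>) = 0" for m
        using fg unfolding K_pow_add[OF \<sigma> bX_abs[OF bX(1)] bX_abs[OF bX(2)]]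
        by (subst Bochner_Integration.integral_add)
          (auto intro!: integrable_bX \<rho> K_pow_bX \<sigma> bX_abs)
    qed (auto intro!: bX_add bX_abs bX)
  next
    fix c :: real and f assume f: "f \<in> ?I"
    then show "(\<lambda>x. c * f x) \<in> ?I"
      by (auto simp: abs_mult K_pow_scale intro: bX_scale)
  next
    fix f g :: "'x \<Rightarrow> real" assume f: "f \<in> ?I" and g: "g \<in> bX" "\<forall>x. \<bar>g x\<bar> \<le> \<bar>f x\<bar>"
    then show "g \<in> ?I"
      by (intro mono[where f = "\<lambda>_ x. \<bar>f x\<bar>"]) (auto intro: bX_abs)
  next
    fix f assume f: "f \<in> ?I"
    then have bX: "f \<in> bX" by auto
    show "K \<sigma> f \<in> ?I"
    proof (rule mono[where f = "\<lambda>_. K \<sigma> (\<lambda>x. \<bar>f x\<bar>)"])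
      show "(\<integral>x. (K \<sigma> ^^ m) (K \<sigma> (\<lambda>x. \<bar>f x\<bar>)) x \<partial>\<rho>) = 0" for m
      proof -
        \<comment> \<open>Invariance shifts the power by one, which is why the ideal asks for all
          powers at once.\<close>
        have "(\<integral>x. (K \<sigma> ^^ Suc m) (\<lambda>x. \<bar>f x\<bar>) x \<partial>\<rho>) = 0" using f by blast
        then show ?thesis by (simp only: funpow_Suc_right comp_apply)
      qed
    qed (auto intro!: K_bX \<sigma> bX_abs bX abs_K_le)
  qed
qed

lemma globally_optimal_if_optimal_on_average:
  assumes \<sigma>: "\<sigma> \<in> policies \<Gamma>" and irr: "strongly_irreducible (P_pol P \<sigma>)"
    and \<rho>: "prob_space \<rho>" "sets \<rho> = sets borel"
    and max: "\<And>s. s \<in> policies \<Gamma> \<Longrightarrow> integral\<^sup>L \<rho> (v s) \<le> integral\<^sup>L \<rho> (v \<sigma>)"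
    and s: "s \<in> policies \<Gamma>"
  shows "v s x \<le> v \<sigma> x"
proof -
  \<comment> \<open>Passing to the better of \<open>s\<close> and \<sigma> makes \<open>h\<close>
    nonnegative, so it equals its absolute value in the ideal.\<close>
  obtain s' where s': "s' \<in> policies \<Gamma>" and ge: "\<And>x. v s x \<le> v s' x" "\<And>x. v \<sigma> x \<le> v s' x"
    using policy_max[OF s \<sigma>] by blast
  define h where "h x = v s' x - v \<sigma> x" for x
  have h: "h \<in> bX" unfolding h_def by (intro bX_diff v_bX s' \<sigma>)
  have h_nonneg: "0 \<le> h x" for x using ge(2) by (simp add: h_def)
  have zero: "(\<integral>x. (K \<sigma> ^^ m) h x \<partial>\<rho>) = 0" for m
  proof (rule antisym)
    obtain u where u: "u \<in> policies \<Gamma>" "\<And>x. \<beta> ^ m * (K \<sigma> ^^ m) h x \<le> v u x - v \<sigma> x"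
      using iterated_improvement[OF \<sigma> s', of m] unfolding h_def by blast
    have "\<beta> ^ m * (\<integral>x. (K \<sigma> ^^ m) h x \<partial>\<rho>) = (\<integral>x. \<beta> ^ m * (K \<sigma> ^^ m) h x \<partial>\<rho>)" by simp
    also have "\<dots> \<le> (\<integral>x. v u x - v \<sigma> x \<partial>\<rho>)"
      by (intro integral_mono_bX \<rho> bX_scale K_pow_bX bX_diff v_bX \<sigma> u h)
    also have "\<dots> = integral\<^sup>L \<rho> (v u) - integral\<^sup>L \<rho> (v \<sigma>)"
      by (intro Bochner_Integration.integral_diff integrable_bX \<rho> v_bX \<sigma> u)
    also have "\<dots> \<le> 0" using max[OF u(1)] by simp
    finally show "(\<integral>x. (K \<sigma> ^^ m) h x \<partial>\<rho>) \<le> 0"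
      using zero_less_power[OF beta(1), of m] by (simp add: mult_le_0_iff)
    have "0 \<le> (K \<sigma> ^^ m) h x" for x
      using K_pow_mono[OF \<sigma> bX_const[of 0] h h_nonneg, of m x] by (simp add: K_pow_zero)
    then show "0 \<le> (\<integral>x. (K \<sigma> ^^ m) h x \<partial>\<rho>)" by (rule Bochner_Integration.integral_nonneg)
  qed
  define I where "I = {f\<in>bX. \<forall>m. (\<integral>x. (K \<sigma> ^^ m) (\<lambda>x. \<bar>f x\<bar>) x \<partial>\<rho>) = 0}"
  have hI: "h \<in> I" using h zero h_nonneg by (simp add: I_def)
  \<comment> \<open>Power 0 gives the total mass 1 of \<rho>.\<close>
  have "(\<lambda>_. 1) \<notin> I"
    using prob_space.prob_space[OF \<rho>(1)] by (auto simp: I_def intro!: exI[of _ 0])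
  then have "I \<noteq> bX" using bX_const[of 1] by metis
  moreover have "I = {\<lambda>x. 0} \<or> I = bX"
    using irr null_ideal_invariant[OF \<sigma> \<rho>]
    unfolding I_def[symmetric] strongly_irreducible_def irreducible_op_def by simp
  ultimately have "h = (\<lambda>x. 0)" using hI by simp
  then have "h x = 0" by simp
  then show ?thesis using ge(1)[of x] by (simp add: h_def)
qed

text \<open>The supremum is over a set bounded above that contains \<open>v \<sigma> x\<close>
  itself.\<close>

lemma optimal_iff:
  assumes \<sigma>: "\<sigma> \<in> policies \<Gamma>"
  shows "optimal r \<Gamma> \<beta> P \<sigma> \<longleftrightarrow> (\<forall>s\<in>policies \<Gamma>. \<forall>x. v s x \<le> v \<sigma> x)"
proof -
  obtain C where "\<forall>s\<in>policies \<Gamma>. \<forall>x. \<bar>v s x\<bar> \<le> C" using v_bound by blast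
  then have bdd: "bdd_above ((\<lambda>s. v s x) ` policies \<Gamma>)" for x
    by (intro bdd_aboveI[of _ C]) (auto dest: abs_le_D1)
  show ?thesis
    unfolding optimal_def v_star_def
  proof (intro iffI ballI allI)
    fix s x assume "\<forall>x. v \<sigma> x = (SUP s\<in>policies \<Gamma>. v s x)" "s \<in> policies \<Gamma>"
    then show "v s x \<le> v \<sigma> x" using cSUP_upper[OF _ bdd] by metis
  next
    fix x assume "\<forall>s\<in>policies \<Gamma>. \<forall>x. v s x \<le> v \<sigma> x"
    then show "v \<sigma> x = (SUP s\<in>policies \<Gamma>. v s x)"
      using \<sigma> by (intro cSup_eq_maximum[symmetric]) auto
  qed
qed

end

theorem theorem3p3:
  fixes r :: "'x::metric_space \<times> 'a::metric_space \<Rightarrow> real"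
    and \<Gamma> :: "'x \<Rightarrow> 'a set" and \<beta> :: real and P :: "'x \<Rightarrow> 'a \<Rightarrow> 'x measure"
    and \<sigma> :: "'x \<Rightarrow> 'a"
  assumes mdp: "is_MDP r \<Gamma> \<beta> P"
    and pol: "\<sigma> \<in> policies \<Gamma>"
    and irr: "strongly_irreducible (P_pol P \<sigma>)"
  shows "((\<exists>x. \<forall>s\<in>policies \<Gamma>. v_pol r \<beta> P s x \<le> v_pol r \<beta> P \<sigma> x)
           \<longleftrightarrow> (\<exists>\<rho>. prob_space \<rho> \<and> sets \<rho> = sets borel \<and>
                 (\<forall>s\<in>policies \<Gamma>. integral\<^sup>L \<rho> (v_pol r \<beta> P s) \<le> integral\<^sup>L \<rho> (v_pol r \<beta> P \<sigma>))))
       \<and> ((\<exists>\<rho>. prob_space \<rho> \<and> sets \<rho> = sets borel \<and>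
                 (\<forall>s\<in>policies \<Gamma>. integral\<^sup>L \<rho> (v_pol r \<beta> P s) \<le> integral\<^sup>L \<rho> (v_pol r \<beta> P \<sigma>)))
           \<longleftrightarrow> optimal r \<Gamma> \<beta> P \<sigma>)"
    (is "(?E1 \<longleftrightarrow> ?E2) \<and> (?E2 \<longleftrightarrow> ?E3)")
proof -
  interpret mdp r \<Gamma> \<beta> P using mdp by unfold_locales
  have "?E2" if E1: "?E1"
  proof -
    obtain x where x: "\<And>s. s \<in> policies \<Gamma> \<Longrightarrow> v s x \<le> v \<sigma> x" using E1 by blast
    \<comment> \<open>The point mass at \<open>x\<close> turns averages into values at
      \<open>x\<close>.\<close>
    have eq: "integral\<^sup>L (return borel x) (v s) = v s x" if "s \<in> policies \<Gamma>" for s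
      using that by (intro integral_return bX_measurable v_bX) auto
    show ?thesis
      by (intro exI[of _ "return borel x"]) (auto simp: eq pol x intro: prob_space_return)
  qed
  moreover have "?E3" if "?E2"
    using that globally_optimal_if_optimal_on_average[OF pol irr] optimal_iff[OF pol] by blast
  \<comment> \<open>Any state is a witness, types being nonempty.\<close>
  moreover have "?E1" if "?E3" using that optimal_iff[OF pol] by blast
  ultimately show ?thesis by blast
qed

end
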